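(* Let $R$ be an Artinian commutative ring with identity. Then the comaximal graph $\mathbb{CG}(R)$ is a complemented graph (equivalently, a uniquely complemented graph).
   Context: For a commutative ring $R$ with identity, the comaximal graph $\mathbb{CG}(R)$ is the graph whose vertices are the elements of $R$, two distinct vertices $x$ and $y$ being adjacent if and only if $Rx+Ry=R$. In a graph $G$, for distinct vertices $a,b$ write $a\bot b$ (and call $b$ a complement of $a$) if $a$ and $b$ are adjacent and there is no vertex of $G$ adjacent to both $a$ and $b$. $G$ is complemented if for each vertex $a$ of $G$ there is a vertex $b$ of $G$ with $a\bot b$. $G$ is uniquely complemented if it is complemented and whenever $a\bot b$ and $a\bot c$, then $b$ and $c$ are adjacent to exactly the same vertices.
   Formalization: With all elements of R as vertices the claim is false (for Z/3Z the graph is a triangle; 0 has no complement if R has two units). The formal theorem concerns the subgraph of CG(R) induced on the nonunits outside the Jacobson radical, and proves it complemented and uniquely complemented. *)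

theory Defs
  imports "HOL-Algebra.Algebra" "Graph_Theory.Graph_Theory"
begin

section \<open>Graphs\<close>

text \<open>
  An undirected simple graph is encoded as a digraph whose arcs form a symmetric irreflexive
  relation; ``$a$ and $b$ are adjacent'' is then \<open>a \<rightarrow>\<^bsub>G\<^esub> b\<close>.
\<close>

definition orthogonal :: "('a, 'b) pre_digraph \<Rightarrow> 'a \<Rightarrow> 'a \<Rightarrow> bool" where
  "orthogonal G a b \<longleftrightarrow>
     a \<in> verts G \<and> b \<in> verts G \<and> a \<noteq> b \<and> a \<rightarrow>\<^bsub>G\<^esub> b \<and>
     \<not> (\<exists>c \<in> verts G. a \<rightarrow>\<^bsub>G\<^esub> c \<and> b \<rightarrow>\<^bsub>G\<^esub> c)"

definition complemented_graph :: "('a, 'b) pre_digraph \<Rightarrow> bool" where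
  "complemented_graph G \<longleftrightarrow> (\<forall>a \<in> verts G. \<exists>b \<in> verts G. orthogonal G a b)"

definition uniquely_complemented_graph :: "('a, 'b) pre_digraph \<Rightarrow> bool" where
  "uniquely_complemented_graph G \<longleftrightarrow>
     complemented_graph G \<and>
     (\<forall>a \<in> verts G. \<forall>b \<in> verts G. \<forall>c \<in> verts G.
        orthogonal G a b \<and> orthogonal G a c \<longrightarrow>
        (\<forall>v \<in> verts G. b \<rightarrow>\<^bsub>G\<^esub> v \<longleftrightarrow> c \<rightarrow>\<^bsub>G\<^esub> v))"

section \<open>Rings\<close>

locale artinian_cring = cring +
  assumes descending_chain_condition:
    "\<lbrakk> \<And>n :: nat. ideal (I n) R; \<And>n. I (Suc n) \<subseteq> I n \<rbrakk> \<Longrightarrow> \<exists>n. \<forall>m \<ge> n. I m = I n"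

text \<open>The intersection with the carrier only matters for the zero ring.\<close>

definition jacobson_radical :: "('a, 'b) ring_scheme \<Rightarrow> 'a set" where
  "jacobson_radical R = carrier R \<inter> \<Inter> {M. maximalideal M R}"

definition comaximal_graph :: "('a, 'b) ring_scheme \<Rightarrow> ('a, 'a \<times> 'a) pre_digraph" where
  "comaximal_graph R =
     \<lparr> verts = carrier R,
       arcs = {(x, y). x \<in> carrier R \<and> y \<in> carrier R \<and> x \<noteq> y \<and>
                       (PIdl\<^bsub>R\<^esub> x) <+>\<^bsub>R\<^esub> (PIdl\<^bsub>R\<^esub> y) = carrier R},
       tail = fst, head = snd \<rparr>"

lemma comaximal_graph_adj:
  "x \<rightarrow>\<^bsub>comaximal_graph R\<^esub> y \<longleftrightarrow>
     x \<in> carrier R \<and> y \<in> carrier R \<and> x \<noteq> y \<and> (PIdl\<^bsub>R\<^esub> x) <+>\<^bsub>R\<^esub> (PIdl\<^bsub>R\<^esub> y) = carrier R"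
  by (force simp: comaximal_graph_def arcs_ends_def arc_to_ends_def)

text \<open>
  Complementedness is meaningful only after two kinds of vertices have been removed. With the
  units present, the vertex \<open>\<zero>\<close> has a complement only if there is exactly one unit (see
  \<open>not_complemented_if_two_units\<close> below; the field with three elements gives a triangle).
  With the units removed, the elements of the Jacobson radical are isolated vertices.
  Hence the usual passage to the subgraph induced on the nonunits outside the
  Jacobson radical.
\<close>

definition proper_comaximal_graph :: "('a, 'b) ring_scheme \<Rightarrow> ('a, 'a \<times> 'a) pre_digraph" where
  "proper_comaximal_graph R =
     comaximal_graph R \<restriction> (carrier R - Units R - jacobson_radical R)"

lemma (in cring) comaximal_if_unit:
  assumes "u \<in> Units R" "x \<in> carrier R"
  shows "(PIdl x) <+>\<^bsub>R\<^esub> (PIdl u) = carrier R" "(PIdl u) <+>\<^bsub>R\<^esub> (PIdl x) = carrier R"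
proof -
  have u: "u \<in> carrier R" using assms by auto
  have sub: "(PIdl x) <+>\<^bsub>R\<^esub> (PIdl u) \<subseteq> carrier R" "(PIdl u) <+>\<^bsub>R\<^esub> (PIdl x) \<subseteq> carrier R"
    using assms u by (auto simp: set_add_def' cgenideal_def)
  have z: "\<zero> \<in> PIdl x" using assms unfolding cgenideal_def by (auto intro!: exI[of _ "\<zero>"])
  have r: "r \<in> PIdl u" if "r \<in> carrier R" for r
  proof -
    have "r = (r \<otimes> inv u) \<otimes> u" using that assms u by (simp add: m_assoc)
    then show ?thesis unfolding cgenideal_def using that assms(1) by blast
  qed
  have "r \<in> (PIdl x) <+>\<^bsub>R\<^esub> (PIdl u)" "r \<in> (PIdl u) <+>\<^bsub>R\<^esub> (PIdl x)" if "r \<in> carrier R" for r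
  proof -
    have "r = \<zero> \<oplus> r" "r = r \<oplus> \<zero>" using that by simp_all
    then show "r \<in> (PIdl x) <+>\<^bsub>R\<^esub> (PIdl u)" "r \<in> (PIdl u) <+>\<^bsub>R\<^esub> (PIdl x)"
      using z r[OF that] unfolding set_add_def' by blast+
  qed
  with sub show "(PIdl x) <+>\<^bsub>R\<^esub> (PIdl u) = carrier R" "(PIdl u) <+>\<^bsub>R\<^esub> (PIdl x) = carrier R" by blast+
qed

lemma (in cring) not_complemented_if_two_units:
  assumes "u \<in> Units R" "v \<in> Units R" "u \<noteq> v"
  shows "\<not> complemented_graph (comaximal_graph R)"
proof
  assume "complemented_graph (comaximal_graph R)"
  moreover have "\<zero> \<in> verts (comaximal_graph R)" by (simp add: comaximal_graph_def)
  ultimately obtain b where b: "orthogonal (comaximal_graph R) \<zero> b"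
    by (auto simp: complemented_graph_def)
  then have bc: "b \<in> carrier R" and eq: "(PIdl \<zero>) <+>\<^bsub>R\<^esub> (PIdl b) = carrier R"
    by (auto simp: orthogonal_def comaximal_graph_adj)
  obtain w where w: "w \<in> Units R" "w \<noteq> b" using assms by metis
  then have wc: "w \<in> carrier R" by auto
  have "w \<noteq> \<zero>"
  proof
    assume "w = \<zero>"
    then have "\<one> = \<zero>" using w(1) Units_l_inv[of w] Units_inv_closed[of w] by simp
    then have "carrier R = {\<zero>}" using one_zeroD by simp
    moreover have "u \<in> carrier R" "v \<in> carrier R" using assms by (simp_all add: Units_closed)
    ultimately have "u = \<zero>" "v = \<zero>" by simp_all
    then show False using assms(3) by simp
  qed
  then have "\<zero> \<rightarrow>\<^bsub>comaximal_graph R\<^esub> w" "b \<rightarrow>\<^bsub>comaximal_graph R\<^esub> w"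
    using w wc bc comaximal_if_unit(1)[OF w(1)] by (auto simp: comaximal_graph_adj)
  moreover have "w \<in> verts (comaximal_graph R)" using wc by (simp add: comaximal_graph_def)
  ultimately show False using b by (auto simp: orthogonal_def)
qed

end

theory Submission
  imports Defs
begin

text \<open>
  Adjacency of \<open>x\<close> and \<open>y\<close> only depends on the maximal ideals containing them: no maximal ideal
  contains both. By the descending chain condition every \<open>a\<close> satisfies \<open>a\<^sup>n = r a\<^sup>2\<^sup>n\<close> for some
  \<open>n > 0\<close>, and then \<open>b = 1 - r a\<^sup>n\<close> lies in exactly those maximal ideals that do not contain \<open>a\<close>.
  Such an element is a complement of \<open>a\<close>. Conversely, if \<open>b\<close> is a complement of \<open>a\<close> and some
  maximal ideal avoids \<open>a b\<close>, then a complement of \<open>a b\<close> is a common neighbour of \<open>a\<close> and \<open>b\<close>;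
  so every complement of \<open>a\<close> lies in exactly the maximal ideals avoiding \<open>a\<close>, which determines
  its neighbours.
\<close>

text \<open>Zorn's lemma, applied to the ideals above \<open>I\<close> that omit
  \<open>\<one>\<close>. For an ideal, omitting \<open>\<one>\<close> is the same as being proper,
  and in this form the condition visibly passes to unions of chains.\<close>

lemma (in cring) exists_maximalideal_superset:
  assumes "ideal I R" "I \<noteq> carrier R"
  shows "\<exists>M. maximalideal M R \<and> I \<subseteq> M"
proof -
  define S where "S = {J. ideal J R \<and> I \<subseteq> J \<and> \<one> \<notin> J}"
  have "I \<in> S" using assms ideal.one_imp_carrier unfolding S_def by blast
  moreover have "\<Union>C \<in> S" if "C \<noteq> {}" "subset.chain S C" for C
  proof -
    have "subset.chain {J. ideal J R} C" "C \<subseteq> S"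
      using that(2) by (auto simp: subset_chain_def S_def)
    then show ?thesis
      using chain_Union_is_ideal[of C] \<open>C \<noteq> {}\<close> unfolding S_def by auto
  qed
  ultimately obtain M where M: "M \<in> S" and max: "\<And>J. J \<in> S \<Longrightarrow> M \<subseteq> J \<Longrightarrow> J = M"
    using subset_Zorn_nonempty[of S] by blast
  have "maximalideal M R"
  proof (rule maximalidealI)
    show "ideal M R" "carrier R \<noteq> M" using M by (auto simp: S_def)
    show "J = M \<or> J = carrier R" if "ideal J R" "M \<subseteq> J" "J \<subseteq> carrier R" for J
      using that M max[of J] ideal.one_imp_carrier[OF that(1)] unfolding S_def by blast
  qed
  with M show ?thesis unfolding S_def by blast
qed

lemma (in maximalideal) one_notin: "\<one> \<notin> I"
  using I_notcarr one_imp_carrier by blast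

text \<open>A nonunit generates a proper principal ideal, which extends to a maximal one.\<close>

lemma (in cring) Units_iff_maximalideal:
  assumes "x \<in> carrier R"
  shows "x \<in> Units R \<longleftrightarrow> (\<forall>M. maximalideal M R \<longrightarrow> x \<notin> M)"
proof
  assume x: "x \<in> Units R"
  show "\<forall>M. maximalideal M R \<longrightarrow> x \<notin> M"
  proof (intro allI impI notI)
    fix M assume M: "maximalideal M R" and "x \<in> M"
    then have "inv x \<otimes> x \<in> M"
      using x by (intro ideal.I_l_closed[OF maximalideal.axioms(1)]) auto
    with x M show False using maximalideal.one_notin by auto
  qed
next
  assume R: "\<forall>M. maximalideal M R \<longrightarrow> x \<notin> M"
  have "PIdl x = carrier R"
    using R exists_maximalideal_superset[OF cgenideal_ideal[OF assms]] cgenideal_self[OF assms]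
    by blast
  then have "\<one> \<in> PIdl x" by simp
  then obtain r where "r \<in> carrier R" "r \<otimes> x = \<one>" unfolding cgenideal_def by auto
  with assms show "x \<in> Units R" unfolding Units_def using m_comm by auto
qed

text \<open>An ideal contains \<open>x\<close> and \<open>y\<close> exactly when it contains the sum
  of their principal ideals, and that sum is proper iff it lies in some maximal ideal.\<close>

lemma (in cring) comaximal_iff_maximalideal:
  assumes x: "x \<in> carrier R" and y: "y \<in> carrier R"
  shows "(PIdl x) <+>\<^bsub>R\<^esub> (PIdl y) = carrier R \<longleftrightarrow> (\<forall>M. maximalideal M R \<longrightarrow> \<not> (x \<in> M \<and> y \<in> M))"
proof -
  let ?S = "(PIdl x) <+>\<^bsub>R\<^esub> (PIdl y)"
  have S: "ideal ?S R" by (intro add_ideals cgenideal_ideal x y)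
  have 0: "\<zero> \<in> PIdl z" if "z \<in> carrier R" for z
    using that additive_subgroup.zero_closed[OF ideal.axioms(1)[OF cgenideal_ideal]] by blast
  have "x \<oplus> \<zero> \<in> ?S" "\<zero> \<oplus> y \<in> ?S"
    using 0 x y cgenideal_self unfolding set_add_def' by blast+
  then have xy: "x \<in> ?S" "y \<in> ?S" using x y by simp_all
  have "?S \<subseteq> M" if "maximalideal M R" "x \<in> M" "y \<in> M" for M
  proof -
    interpret M: ideal M R using that(1) by (rule maximalideal.axioms(1))
    have "PIdl x \<subseteq> M" "PIdl y \<subseteq> M" using that by (simp_all add: cgenideal_minimal M.ideal_axioms)
    then show ?thesis unfolding set_add_def' by (auto intro: M.a_closed)
  qed
  then show ?thesis
    using exists_maximalideal_superset[OF S] xy maximalideal.one_notin by blast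
qed

lemma (in cring) maximalideal_mult_iff:
  assumes M: "maximalideal M R" and x: "x \<in> carrier R" and y: "y \<in> carrier R"
  shows "x \<otimes> y \<in> M \<longleftrightarrow> x \<in> M \<or> y \<in> M"
proof -
  interpret primeideal M R using maximalideal_prime[OF M] .
  show ?thesis using I_prime I_l_closed I_r_closed x y by blast
qed

lemma (in cring) maximalideal_pow_iff:
  assumes M: "maximalideal M R" and x: "x \<in> carrier R"
  shows "x [^] (n :: nat) \<in> M \<longleftrightarrow> n > 0 \<and> x \<in> M"
  using maximalideal.one_notin[OF M]
  by (induction n) (auto simp: maximalideal_mult_iff[OF M] x)

text \<open>The ideals generated by the powers of \<open>a\<close> form a descending chain, which
  becomes stationary; comparing the generators for exponents \<open>n\<close> and \<open>2n\<close>
  far enough along gives \<open>r\<close>.\<close>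

lemma (in artinian_cring) strongly_pi_regular:
  assumes a: "a \<in> carrier R"
  shows "\<exists>n > (0 :: nat). \<exists>r \<in> carrier R. a [^] n = r \<otimes> (a [^] n \<otimes> a [^] n)"
proof -
  have "PIdl (a [^] Suc n) \<subseteq> PIdl (a [^] n)" for n :: nat
  proof (rule cgenideal_minimal)
    show "ideal (PIdl (a [^] n)) R" using a by (simp add: cgenideal_ideal)
    have "a [^] Suc n = a \<otimes> a [^] n" using a by (simp add: m_comm)
    then show "a [^] Suc n \<in> PIdl (a [^] n)" unfolding cgenideal_def using a by blast
  qed
  then obtain n :: nat where n: "\<And>m. m \<ge> n \<Longrightarrow> PIdl (a [^] m) = PIdl (a [^] n)"
    using descending_chain_condition[of "\<lambda>n. PIdl (a [^] n)"] a
    by (metis cgenideal_ideal nat_pow_closed)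
  \<comment> \<open>The successor makes the exponent positive. With exponent 0 the equation would
    hold for \<open>r = \<one>\<close> and say nothing about \<open>a\<close>.\<close>
  let ?k = "Suc n"
  have "PIdl (a [^] ?k) = PIdl (a [^] (?k + ?k))"
    using n[of ?k] n[of "?k + ?k"] by simp
  then have "a [^] ?k \<in> PIdl (a [^] (?k + ?k))"
    using cgenideal_self[of "a [^] ?k"] a by (simp del: nat_pow_Suc)
  then obtain r where "r \<in> carrier R" "a [^] ?k = r \<otimes> a [^] (?k + ?k)"
    unfolding cgenideal_def by blast
  then show ?thesis using nat_pow_mult[OF a, of ?k ?k] zero_less_Suc by metis
qed

lemma (in artinian_cring) exists_maximalideal_complement:
  assumes a: "a \<in> carrier R"
  shows "\<exists>b \<in> carrier R. \<forall>M. maximalideal M R \<longrightarrow> (b \<in> M \<longleftrightarrow> a \<notin> M)"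
proof -
  obtain n :: nat and r where n: "n > 0" and r: "r \<in> carrier R"
    and eq: "a [^] n = r \<otimes> (a [^] n \<otimes> a [^] n)"
    using strongly_pi_regular[OF a] by blast
  define p where "p = a [^] n"
  have p: "p \<in> carrier R" using a by (simp add: p_def)
  \<comment> \<open>Since \<open>p = r \<otimes> (p \<otimes> p)\<close>, the element
    \<open>r \<otimes> p\<close> is idempotent and \<open>b\<close> is the complementary idempotent.
    From \<open>p \<otimes> b = \<zero>\<close> every maximal ideal, being prime, contains
    \<open>p\<close> or \<open>b\<close>; from \<open>b \<oplus> r \<otimes> p = \<one>\<close> none
    contains both.\<close>
  define b where "b = \<one> \<ominus> r \<otimes> p"
  have b: "b \<in> carrier R" using r p by (simp add: b_def)
  have "p \<otimes> b = p \<ominus> r \<otimes> (p \<otimes> p)" unfolding b_def using r p by algebra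
  then have pb: "p \<otimes> b = \<zero>" using eq p by (simp add: p_def[symmetric] r_neg a_minus_def)
  have sum: "b \<oplus> r \<otimes> p = \<one>" unfolding b_def using r p by algebra
  have "b \<in> M \<longleftrightarrow> a \<notin> M" if M: "maximalideal M R" for M
  proof -
    interpret M: maximalideal M R by fact
    have "p \<in> M \<longleftrightarrow> a \<in> M" unfolding p_def using maximalideal_pow_iff[OF M a] n by simp
    moreover have "p \<in> M \<or> b \<in> M"
      using maximalideal_mult_iff[OF M p b] pb M.zero_closed by simp
    moreover have "\<not> (p \<in> M \<and> b \<in> M)"
      using M.a_closed[of b "r \<otimes> p"] M.I_l_closed[OF _ r] sum M.one_notin by metis
    ultimately show ?thesis by blast
  qed
  with b show ?thesis by blast
qed

text \<open>The two existence conditions express being a nonunit and lying outside the radical. They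
  are exchanged when an element is replaced by one lying in exactly the other maximal
  ideals.\<close>

lemma (in cring) verts_proper_comaximal_graph:
  "x \<in> verts (proper_comaximal_graph R) \<longleftrightarrow>
     x \<in> carrier R \<and> (\<exists>M. maximalideal M R \<and> x \<in> M) \<and> (\<exists>M. maximalideal M R \<and> x \<notin> M)"
  using Units_iff_maximalideal
  by (auto simp: proper_comaximal_graph_def jacobson_radical_def)

lemma (in cring) proper_comaximal_graph_adj:
  assumes x: "x \<in> verts (proper_comaximal_graph R)" and y: "y \<in> verts (proper_comaximal_graph R)"
  shows "x \<rightarrow>\<^bsub>proper_comaximal_graph R\<^esub> y \<longleftrightarrow>
           (\<forall>M. maximalideal M R \<longrightarrow> \<not> (x \<in> M \<and> y \<in> M))"
proof -
  have c: "x \<in> carrier R" "y \<in> carrier R" using x y by (auto simp: verts_proper_comaximal_graph)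
  have "x \<rightarrow>\<^bsub>proper_comaximal_graph R\<^esub> y \<longleftrightarrow> x \<rightarrow>\<^bsub>comaximal_graph R\<^esub> y"
    using x y
    by (force simp: proper_comaximal_graph_def comaximal_graph_def arcs_ends_def arc_to_ends_def)
  also have "\<dots> \<longleftrightarrow> x \<noteq> y \<and> (\<forall>M. maximalideal M R \<longrightarrow> \<not> (x \<in> M \<and> y \<in> M))"
    using c by (simp add: comaximal_graph_adj comaximal_iff_maximalideal)
  \<comment> \<open>The vertex \<open>x\<close> lies in some maximal ideal, so the condition on
    maximal ideals already forces \<open>x \<noteq> y\<close>.\<close>
  finally show ?thesis using x by (auto simp: verts_proper_comaximal_graph)
qed

lemma (in artinian_cring) orthogonal_proper_comaximal_graph_iff:
  assumes a: "a \<in> verts (proper_comaximal_graph R)" and b: "b \<in> verts (proper_comaximal_graph R)"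
  shows "orthogonal (proper_comaximal_graph R) a b \<longleftrightarrow>
           (\<forall>M. maximalideal M R \<longrightarrow> (b \<in> M \<longleftrightarrow> a \<notin> M))"
    (is "?orth \<longleftrightarrow> ?compl")
proof
  note verts = verts_proper_comaximal_graph
  have c: "a \<in> carrier R" "b \<in> carrier R" using a b by (auto simp: verts)
  show ?compl if orth: ?orth
  proof (intro allI impI)
    fix M assume M: "maximalideal M R"
    have "\<not> (a \<in> M \<and> b \<in> M)"
      using orth M proper_comaximal_graph_adj[OF a b] by (auto simp: orthogonal_def)
    moreover have "a \<in> M \<or> b \<in> M"
    proof (rule ccontr)
      assume nM: "\<not> (a \<in> M \<or> b \<in> M)"
      obtain d where d: "d \<in> carrier R"
        and dM: "\<And>N. maximalideal N R \<Longrightarrow> d \<in> N \<longleftrightarrow> a \<notin> N \<and> b \<notin> N"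
        using exists_maximalideal_complement[of "a \<otimes> b"] maximalideal_mult_iff c by fastforce
      \<comment> \<open>\<open>d\<close> lies in \<open>M\<close>, and it avoids any maximal ideal
        containing the vertex \<open>a\<close>.\<close>
      have dv: "d \<in> verts (proper_comaximal_graph R)"
        using a d M nM dM unfolding verts by blast
      have "a \<rightarrow>\<^bsub>proper_comaximal_graph R\<^esub> d" "b \<rightarrow>\<^bsub>proper_comaximal_graph R\<^esub> d"
        using proper_comaximal_graph_adj[OF a dv] proper_comaximal_graph_adj[OF b dv] dM by blast+
      with orth dv show False by (auto simp: orthogonal_def)
    qed
    ultimately show "b \<in> M \<longleftrightarrow> a \<notin> M" by blast
  qed
  show ?orth if compl: ?compl
    unfolding orthogonal_def
  proof (intro conjI notI)
    show "a = b \<Longrightarrow> False" using a compl by (auto simp: verts)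
    show "a \<rightarrow>\<^bsub>proper_comaximal_graph R\<^esub> b" using proper_comaximal_graph_adj[OF a b] compl by blast
    assume "\<exists>c \<in> verts (proper_comaximal_graph R).
              a \<rightarrow>\<^bsub>proper_comaximal_graph R\<^esub> c \<and> b \<rightarrow>\<^bsub>proper_comaximal_graph R\<^esub> c"
    then obtain c where cv: "c \<in> verts (proper_comaximal_graph R)"
      and "\<forall>M. maximalideal M R \<longrightarrow> \<not> (a \<in> M \<and> c \<in> M)"
      and "\<forall>M. maximalideal M R \<longrightarrow> \<not> (b \<in> M \<and> c \<in> M)"
      using proper_comaximal_graph_adj a b by blast
    \<comment> \<open>Every maximal ideal contains \<open>a\<close> or \<open>b\<close>, so
      \<open>c\<close> would lie in none, although it is a vertex.\<close>
    with compl show False by (auto simp: verts)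
  qed (use a b in auto)
qed

theorem theorem3p5:
  fixes R :: "('a, 'b) ring_scheme"
  assumes "artinian_cring R"
  shows "complemented_graph (proper_comaximal_graph R) \<and>
         uniquely_complemented_graph (proper_comaximal_graph R)"
proof -
  interpret artinian_cring R by fact
  let ?G = "proper_comaximal_graph R"
  have "\<exists>b \<in> verts ?G. orthogonal ?G a b" if a: "a \<in> verts ?G" for a
  proof -
    obtain b where b: "b \<in> carrier R" "\<forall>M. maximalideal M R \<longrightarrow> (b \<in> M \<longleftrightarrow> a \<notin> M)"
      using exists_maximalideal_complement a by (auto simp: verts_proper_comaximal_graph)
    then have "b \<in> verts ?G" using a unfolding verts_proper_comaximal_graph by blast
    with b a show ?thesis using orthogonal_proper_comaximal_graph_iff by blast
  qed
  then have compl: "complemented_graph ?G" unfolding complemented_graph_def by blast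
  \<comment> \<open>Both \<open>b\<close> and \<open>c\<close> lie in exactly the maximal ideals
    avoiding \<open>a\<close>, hence in the same ones.\<close>
  have "b \<rightarrow>\<^bsub>?G\<^esub> v \<longleftrightarrow> c \<rightarrow>\<^bsub>?G\<^esub> v"
    if "a \<in> verts ?G" "b \<in> verts ?G" "c \<in> verts ?G" "v \<in> verts ?G"
      "orthogonal ?G a b" "orthogonal ?G a c" for a b c v
    using that orthogonal_proper_comaximal_graph_iff[of a] proper_comaximal_graph_adj[of _ v]
    by simp
  with compl show ?thesis unfolding uniquely_complemented_graph_def by blast
qed

end
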